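(* Let $(\mu;\eta_0)\in E\times\mathbb R$ with $\mu\neq0$ be such that $\langle\mu,u\rangle\ge0$ for all $u\in\mathcal K$ with $Au=0$, and such that either $\eta_0\le\inf_{b\in\mathcal B}\sigma_{D_\mu}(b)$ or $(\mu;\eta_0)$ is a valid inequality for $\mathcal S(A,\mathcal K,\mathcal B)$, where $D_\mu=\{\lambda\in\mathbb R^m:\mu-A^*\lambda\in\mathcal K^*\}$. If there exist $x^i\in\mathrm{Ext}(\mathcal K)$, $i\in I$ ($I$ a finite index set), such that $\sigma_{D_\mu}(Ax^i)=\langle\mu,x^i\rangle$ for all $i\in I$ and $\sum_{i\in I}x^i\in\mathrm{int}(\mathcal K)$, then the inequality $(\mu;\eta_0)$ is $\mathcal K$-sublinear.
   Context: $E$ is a finite-dimensional Euclidean space with inner product $\langle\cdot,\cdot\rangle$; $\mathcal K\subset E$ is a regular cone (closed, convex, pointed, full-dimensional); $\mathcal K^*=\{y\in E:\langle x,y\rangle\ge0\ \forall x\in\mathcal K\}$ is its dual cone; $\mathrm{Ext}(\cdot)$ denotes the set of (nonzero vectors spanning) extreme rays of a cone; $A:E\to\mathbb R^m$ is linear with conjugate map $A^*:\mathbb R^m\to E$ given by $y^TAx=\langle A^*y,x\rangle$; $\mathcal B\subseteq\mathbb R^m$ is an arbitrary nonempty set; $\mathcal S(A,\mathcal K,\mathcal B)=\{x\in\mathcal K: Ax\in\mathcal B\}$, assumed to satisfy $\mathcal S(A,\mathcal K,\mathcal B)\neq\emptyset$ and $\mathcal S(A,\mathcal K,\mathcal B)\ne\mathcal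 K$. $(\mu;\eta_0)$ is a valid inequality if $\langle\mu,x\rangle\ge\eta_0$ for all $x\in\mathcal S(A,\mathcal K,\mathcal B)$. The support function of $D\subseteq\mathbb R^m$ is $\sigma_D(z)=\sup\{z^T\lambda:\lambda\in D\}$ (with $\sup\emptyset=-\infty$). An inequality $(\mu;\eta_0)$ with $\mu\ne0$, $\eta_0\in\mathbb R$, is $\mathcal K$-sublinear if (A.1) for every $\alpha\in\mathrm{Ext}(\mathcal K^* )$: $0\le\langle\mu,u\rangle$ for all $u\in E$ such that $Au=0$ and $\langle\alpha,v\rangle u+v\in\mathcal K$ for all $v\in\mathrm{Ext}(\mathcal K)$; and (A.2) $\eta_0\le\langle\mu,x\rangle$ for all $x\in\mathcal S(A,\mathcal K,\mathcal B)$. *)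

theory Defs
  imports "HOL-Analysis.Analysis"
begin

definition regular_cone :: "'a::euclidean_space set \<Rightarrow> bool" where
  "regular_cone K \<longleftrightarrow>
     convex_cone K \<and> closed K \<and> K \<inter> uminus ` K = {0} \<and> interior K \<noteq> {}"

definition dual_cone :: "'a::real_inner set \<Rightarrow> 'a set" where
  "dual_cone K = {y. \<forall>x\<in>K. x \<bullet> y \<ge> 0}"

(* All nonzero generators of extreme rays, not one normalized representative per ray.
   For x \<noteq> 0, conic hull {x} is the ray {c *\<^sub>R x | c \<ge> 0}. *)
definition Ext :: "'a::real_vector set \<Rightarrow> 'a set" where
  "Ext K = {x. x \<noteq> 0 \<and> conic hull {x} face_of K}"

definition conic_feasible_set ::
  "('a \<Rightarrow> 'b) \<Rightarrow> 'a set \<Rightarrow> 'b set \<Rightarrow> 'a set" where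
  "conic_feasible_set A K B = {x \<in> K. A x \<in> B}"

definition valid_inequality ::
  "('a::real_inner \<Rightarrow> 'b) \<Rightarrow> 'a set \<Rightarrow> 'b set \<Rightarrow> 'a \<Rightarrow> real \<Rightarrow> bool" where
  "valid_inequality A K B \<mu> \<eta>\<^sub>0 \<longleftrightarrow> (\<forall>x\<in>conic_feasible_set A K B. \<mu> \<bullet> x \<ge> \<eta>\<^sub>0)"

(* Extended-real valued: the supremum is - \<infinity> for D = {} and may be \<infinity>. *)
definition support_function :: "'b::real_inner set \<Rightarrow> 'b \<Rightarrow> ereal" where
  "support_function D z = (SUP l\<in>D. ereal (z \<bullet> l))"

definition D_set ::
  "('a::euclidean_space \<Rightarrow> real ^ 'm) \<Rightarrow> 'a set \<Rightarrow> 'a \<Rightarrow> (real ^ 'm) set" where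
  "D_set A K \<mu> = {l. \<mu> - adjoint A l \<in> dual_cone K}"

definition K_sublinear ::
  "('a::euclidean_space \<Rightarrow> real ^ 'm) \<Rightarrow> 'a set \<Rightarrow> (real ^ 'm) set \<Rightarrow> 'a \<Rightarrow> real \<Rightarrow> bool" where
  "K_sublinear A K B \<mu> \<eta>\<^sub>0 \<longleftrightarrow>
     \<mu> \<noteq> 0 \<and>
     (\<forall>\<alpha>\<in>Ext (dual_cone K). \<forall>u.
        A u = 0 \<and> (\<forall>v\<in>Ext K. (\<alpha> \<bullet> v) *\<^sub>R u + v \<in> K) \<longrightarrow> 0 \<le> \<mu> \<bullet> u) \<and>
     (\<forall>x\<in>conic_feasible_set A K B. \<eta>\<^sub>0 \<le> \<mu> \<bullet> x)"

end

theory Submission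
  imports Defs
begin

text \<open>
  Everything rests on weak conic duality (\<open>support_function_image_le\<close>): for every point of the
  cone, the support function of the dual feasible set, evaluated at the image of that point under
  the linear map, is at most the value of the objective there.  In condition (A.1), moving a
  generator \<open>v\<close> to \<open>(\<alpha> \<bullet> v) *\<^sub>R u + v\<close> stays in the cone and does not change its image,
  because \<open>u\<close> lies in the kernel.  Hence if duality is tight at \<open>v\<close>, the move cannot decrease the
  objective, that is, \<open>(\<alpha> \<bullet> v) * (\<mu> \<bullet> u)\<close> is nonnegative.  A single tight generator says nothing
  about \<open>\<mu> \<bullet> u\<close> if it is orthogonal to \<open>\<alpha>\<close>, which is why the tight generators are required to
  sum to an interior point: adding up the inequalities gives the factor \<open>\<alpha> \<bullet> (\<Sum>i\<in>I. x i)\<close>, and a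
  nonzero dual vector is strictly positive on the interior
  (\<open>dual_cone_inner_interior_pos\<close>), so that this factor can be cancelled.
  Condition (A.2) is validity itself, which under the support function hypothesis is again weak
  duality, now at the feasible points.
\<close>

text \<open>
  From an interior point one can take a small step in the direction \<open>- \<alpha>\<close> without leaving the
  set; the step lowers the value of \<open>\<alpha>\<close>, which is still nonnegative afterwards.
\<close>

lemma dual_cone_inner_interior_pos:
  fixes \<alpha> z :: "'a::real_inner"
  assumes "\<alpha> \<in> dual_cone K" and "\<alpha> \<noteq> 0" and "z \<in> interior K"
  shows "0 < \<alpha> \<bullet> z"
proof -
  obtain e where "e > 0" and e: "cball z e \<subseteq> K"
    using assms(3) by (auto simp: mem_interior_cball)
  define t where "t = e / norm \<alpha>"
  have "t > 0" using \<open>e > 0\<close> assms(2) by (simp add: t_def)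
  have "z - t *\<^sub>R \<alpha> \<in> cball z e"
    using \<open>e > 0\<close> assms(2) by (simp add: t_def dist_norm)
  then have "0 \<le> (z - t *\<^sub>R \<alpha>) \<bullet> \<alpha>"
    using e assms(1) unfolding dual_cone_def by blast
  moreover have "0 < t * (\<alpha> \<bullet> \<alpha>)"
    using \<open>t > 0\<close> assms(2) by simp
  ultimately show ?thesis
    by (simp only: inner_diff_left inner_scaleR_left inner_commute[of z])
qed

text \<open>
  Weak duality: a dual feasible \<open>l\<close> pairs with the image of \<open>w\<close> as its adjoint pairs with \<open>w\<close>,
  and the slack \<open>\<mu> - adjoint A l\<close> is nonnegative at \<open>w\<close>.
\<close>

lemma support_function_image_le:
  fixes A :: "'a::euclidean_space \<Rightarrow> real ^ 'm"
  assumes "linear A" and "w \<in> K"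
  shows "support_function (D_set A K \<mu>) (A w) \<le> ereal (\<mu> \<bullet> w)"
  unfolding support_function_def
proof (rule SUP_least)
  fix l assume "l \<in> D_set A K \<mu>"
  then have "0 \<le> w \<bullet> (\<mu> - adjoint A l)"
    using assms(2) by (auto simp: D_set_def dual_cone_def)
  also have "\<dots> = \<mu> \<bullet> w - A w \<bullet> l"
    by (simp add: inner_diff_right adjoint_works[OF assms(1)] inner_commute)
  finally show "ereal (A w \<bullet> l) \<le> ereal (\<mu> \<bullet> w)" by simp
qed

text \<open>
  A point of the cone where weak duality is tight minimizes the objective over its fibre, since
  the dual bound depends on the image of the point only.
\<close>

lemma tight_point_minimizes_fibre:
  fixes A :: "'a::euclidean_space \<Rightarrow> real ^ 'm"
  assumes "linear A" and "w \<in> K" and "A w = A v"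
    and "support_function (D_set A K \<mu>) (A v) = ereal (\<mu> \<bullet> v)"
  shows "\<mu> \<bullet> v \<le> \<mu> \<bullet> w"
  using support_function_image_le[OF assms(1,2), of \<mu>] assms(3,4) by simp

lemma valid_inequality_if_le_support_function:
  fixes A :: "'a::euclidean_space \<Rightarrow> real ^ 'm"
  assumes "linear A"
    and "ereal \<eta> \<le> (INF b\<in>B. support_function (D_set A K \<mu>) b)"
  shows "valid_inequality A K B \<mu> \<eta>"
  unfolding valid_inequality_def
proof
  fix w assume "w \<in> conic_feasible_set A K B"
  then have w: "w \<in> K" "A w \<in> B" by (auto simp: conic_feasible_set_def)
  have "ereal \<eta> \<le> support_function (D_set A K \<mu>) (A w)"
    using assms(2) INF_lower[OF w(2)] by (rule order_trans)
  also have "\<dots> \<le> ereal (\<mu> \<bullet> w)"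
    by (rule support_function_image_le[OF assms(1) w(1)])
  finally show "\<eta> \<le> \<mu> \<bullet> w" by simp
qed

theorem proposition4p5:
  fixes A :: "'a::euclidean_space \<Rightarrow> real ^ 'm"
    and K :: "'a set"
    and B :: "(real ^ 'm) set"
    and \<mu> :: 'a
    and \<eta>\<^sub>0 :: real
    and I :: "'i set"
    and x :: "'i \<Rightarrow> 'a"
  assumes "regular_cone K"
    and "linear A"
    and "B \<noteq> {}"
    and "conic_feasible_set A K B \<noteq> {}"
    and "conic_feasible_set A K B \<noteq> K"
    and "\<mu> \<noteq> 0"
    and "\<And>u. u \<in> K \<Longrightarrow> A u = 0 \<Longrightarrow> \<mu> \<bullet> u \<ge> 0"
    and "ereal \<eta>\<^sub>0 \<le> (INF b\<in>B. support_function (D_set A K \<mu>) b) \<or>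
         valid_inequality A K B \<mu> \<eta>\<^sub>0"
    and "finite I"
    and "\<And>i. i \<in> I \<Longrightarrow> x i \<in> Ext K"
    and "\<And>i. i \<in> I \<Longrightarrow> support_function (D_set A K \<mu>) (A (x i)) = ereal (\<mu> \<bullet> x i)"
    and "(\<Sum>i\<in>I. x i) \<in> interior K"
  shows "K_sublinear A K B \<mu> \<eta>\<^sub>0"
proof -
  have valid: "valid_inequality A K B \<mu> \<eta>\<^sub>0"
    using assms(8) valid_inequality_if_le_support_function[OF assms(2)] by blast
  have "0 \<le> \<mu> \<bullet> u"
    if \<alpha>: "\<alpha> \<in> Ext (dual_cone K)" and u: "A u = 0"
      and shift: "\<And>v. v \<in> Ext K \<Longrightarrow> (\<alpha> \<bullet> v) *\<^sub>R u + v \<in> K" for \<alpha> u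
  proof -
    have "\<alpha> \<noteq> 0" and "conic hull {\<alpha>} \<subseteq> dual_cone K"
      using \<alpha> by (auto simp: Ext_def dest: face_of_imp_subset)
    then have "\<alpha> \<in> dual_cone K"
      using hull_subset[of "{\<alpha>}" conic] by blast
    then have pos: "0 < \<alpha> \<bullet> (\<Sum>i\<in>I. x i)"
      using \<open>\<alpha> \<noteq> 0\<close> assms(12) by (rule dual_cone_inner_interior_pos)
    have "0 \<le> (\<alpha> \<bullet> x i) * (\<mu> \<bullet> u)" if "i \<in> I" for i
    proof -
      let ?w = "(\<alpha> \<bullet> x i) *\<^sub>R u + x i"
      have "A ?w = A (x i)"
        using u by (simp add: linear_add[OF assms(2)] linear_scale[OF assms(2)])
      then have "\<mu> \<bullet> x i \<le> \<mu> \<bullet> ?w"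
        using assms(2,10,11) shift that by (blast intro: tight_point_minimizes_fibre)
      then show ?thesis by (simp add: inner_add_right)
    qed
    then have "0 \<le> (\<Sum>i\<in>I. (\<alpha> \<bullet> x i) * (\<mu> \<bullet> u))"
      by (rule sum_nonneg)
    also have "\<dots> = (\<alpha> \<bullet> (\<Sum>i\<in>I. x i)) * (\<mu> \<bullet> u)"
      by (simp add: inner_sum_right sum_distrib_right)
    finally show ?thesis
      using pos by (simp add: zero_le_mult_iff)
  qed
  then show ?thesis
    using assms(6) valid by (auto simp: K_sublinear_def valid_inequality_def)
qed

end
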